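(* Let $\Sigma_3=\{a<b<c\}$ and let $w\in \Sigma_3^*$ be $M$-ambiguous. The $M$-equivalence class $[w]$ is $\mathbb{P}$-distinguishable if and only if $[w]$ is trivially $\mathbb{P}$-distinguishable.
   Context: For an ordered alphabet $\Sigma=\{a_1<a_2<\dots<a_s\}$, the Parikh matrix mapping $\Psi_\Sigma$ is the monoid morphism from $\Sigma^*$ to the multiplicative monoid of $(s+1)\times(s+1)$ upper triangular matrices with nonnegative integer entries and unit diagonal, where $\Psi_\Sigma(a_q)$ is the identity matrix with the additional entry $1$ in position $(q,q+1)$. Equivalently (known fact), for $1\le i\le j\le s$ the $(i,j+1)$ entry of $\Psi_\Sigma(w)$ is $|w|_{a_ia_{i+1}\cdots a_j}$, where $|w|_v$ is the number of distinct occurrences of $v$ as a (scattered) subsequence of $w$. Words $w,w'\in\Sigma^*$ are $M$-equivalent, $w\equiv_M w'$, if $\Psi_\Sigma(w)=\Psi_\Sigma(w')$; $[w]$ denotes the $M$-equivalence class of $w$ ($M$-class). A word is $M$-ambiguous if it is $M$-equivalent to a word distinct from it, and $M$-unambiguous otherwise. For $S\subseteq\Sigma$, $\pi_S:\Sigma^*\to S^*$ is the projective morphism that erases all letters not in $S$, and $\Psi_S$ is the Parikh matrix mapping with respect to $S$ with the ordering inherited from $\Sigma$. Words $w,w'\in\Sigma^*$ are $\mathbb{P}$-distinct if $\Psi_S(\pi_S(w))\ne\Psi_S(\pi_S(w'))$ for some $S\subseteq\Sigma$. For $M$-ambiguous $w$, $[w]$ is $\mathbb{P}$-distinguishable if there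 is $w'\in[w]$ such that $w$ and $w'$ are $\mathbb{P}$-distinct. The class $[w]$ is trivially $\mathbb{P}$-distinguishable if some $w'\in[w]$ contains a (contiguous) factor of length two $a_ia_j$ with $|i-j|\ge 2$ (two letters non-consecutive in the ordering). For $\{a<b<c\}$ this means that some $w'\in[w]$ contains $ac$ or $ca$ as a factor. *)

theory Defs
  imports "Jordan_Normal_Form.Matrix" "HOL-Library.Sublist"
begin

text \<open>An ordered alphabet is a finite set of elements of a linearly ordered type, so that every
  subset inherits the ordering. Its \<open>i\<close>-th letter, counted from \<open>0\<close>, is
  \<open>sorted_list_of_set \<Sigma> ! i\<close>; thus the letter \<open>a_q\<close> of the
  literature has index \<open>q - 1\<close>, in accordance with the \<open>0\<close>-based indexing of matrices.\<close>

definition letter_matrix :: "'a::linorder set \<Rightarrow> 'a \<Rightarrow> nat mat" where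
  "letter_matrix \<Sigma> x = mat (Suc (card \<Sigma>)) (Suc (card \<Sigma>))
     (\<lambda>(i, j). if i = j \<or> j = Suc i \<and> sorted_list_of_set \<Sigma> ! i = x then 1 else 0)"

primrec parikh_matrix :: "'a::linorder set \<Rightarrow> 'a list \<Rightarrow> nat mat" where
  "parikh_matrix \<Sigma> [] = 1\<^sub>m (Suc (card \<Sigma>))"
| "parikh_matrix \<Sigma> (x # w) = letter_matrix \<Sigma> x * parikh_matrix \<Sigma> w"

lemma letter_matrix_carrier [simp]:
  "letter_matrix \<Sigma> x \<in> carrier_mat (Suc (card \<Sigma>)) (Suc (card \<Sigma>))"
  by (simp add: letter_matrix_def)

lemma parikh_matrix_carrier [simp]:
  "parikh_matrix \<Sigma> w \<in> carrier_mat (Suc (card \<Sigma>)) (Suc (card \<Sigma>))"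
  by (induction w) (auto intro: mult_carrier_mat[OF letter_matrix_carrier])

lemma parikh_matrix_singleton: "parikh_matrix \<Sigma> [x] = letter_matrix \<Sigma> x"
  using right_mult_one_mat[OF letter_matrix_carrier] by simp

lemma parikh_matrix_append:
  "parikh_matrix \<Sigma> (u @ v) = parikh_matrix \<Sigma> u * parikh_matrix \<Sigma> v"
proof (induction u)
  case Nil
  then show ?case
    by (simp add: left_mult_one_mat[OF parikh_matrix_carrier])
next
  case (Cons x u)
  then show ?case
    by (simp add: assoc_mult_mat[OF letter_matrix_carrier parikh_matrix_carrier
          parikh_matrix_carrier])
qed

definition M_equiv :: "'a::linorder set \<Rightarrow> 'a list \<Rightarrow> 'a list \<Rightarrow> bool" where
  "M_equiv \<Sigma> w w' \<longleftrightarrow>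
     w \<in> lists \<Sigma> \<and> w' \<in> lists \<Sigma> \<and> parikh_matrix \<Sigma> w = parikh_matrix \<Sigma> w'"

definition M_class :: "'a::linorder set \<Rightarrow> 'a list \<Rightarrow> 'a list set" where
  "M_class \<Sigma> w = {w'. M_equiv \<Sigma> w w'}"

definition M_ambiguous :: "'a::linorder set \<Rightarrow> 'a list \<Rightarrow> bool" where
  "M_ambiguous \<Sigma> w \<longleftrightarrow> (\<exists>w'. M_equiv \<Sigma> w w' \<and> w' \<noteq> w)"

definition projection :: "'a set \<Rightarrow> 'a list \<Rightarrow> 'a list" where
  "projection S w = filter (\<lambda>x. x \<in> S) w"

definition P_distinct :: "'a::linorder set \<Rightarrow> 'a list \<Rightarrow> 'a list \<Rightarrow> bool" where
  "P_distinct \<Sigma> w w' \<longleftrightarrow>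
     (\<exists>S\<subseteq>\<Sigma>. parikh_matrix S (projection S w) \<noteq> parikh_matrix S (projection S w'))"

text \<open>The following two predicates express properties of the class \<open>M_class \<Sigma> w\<close>, given by
  its representative \<open>w\<close>.\<close>

definition P_distinguishable :: "'a::linorder set \<Rightarrow> 'a list \<Rightarrow> bool" where
  "P_distinguishable \<Sigma> w \<longleftrightarrow> (\<exists>w'\<in>M_class \<Sigma> w. P_distinct \<Sigma> w w')"

definition trivially_P_distinguishable :: "'a::linorder set \<Rightarrow> 'a list \<Rightarrow> bool" where
  "trivially_P_distinguishable \<Sigma> w \<longleftrightarrow>
     (\<exists>w'\<in>M_class \<Sigma> w. \<exists>i<card \<Sigma>. \<exists>j<card \<Sigma>. \<bar>int i - int j\<bar> \<ge> 2 \<and>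
        sublist [sorted_list_of_set \<Sigma> ! i, sorted_list_of_set \<Sigma> ! j] w')"

end

theory Submission
  imports Defs
begin

text \<open>
  Let \<open>occ v w\<close> be the number of occurrences of \<open>v\<close> as a scattered subsequence of \<open>w\<close>. The Parikh
  matrix over \<open>{a < b < c}\<close> records \<open>occ v\<close> for the six words \<open>v\<close> among
  \<open>a, b, c, ab, bc, abc\<close>, and the only further datum seen by the projections to subalphabets is
  \<open>occ ac\<close>. So the class of \<open>w\<close> is distinguishable iff \<open>occ ac\<close> is not constant on it. Exchanging
  the letters of a factor \<open>ac\<close> or \<open>ca\<close> stays in the class and changes \<open>occ ac\<close> by one, which
  gives one direction. For the other one, call a word \<open>clean\<close> if no word of its class has a factor
  \<open>ac\<close> or \<open>ca\<close>; it has to be shown that \<open>occ ac\<close> is constant on the class of a clean word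
  (\<open>clean_AC_invariant\<close>).

  It helps to see a word as a lattice path in which \<open>a\<close> is a step to the right, \<open>c\<close> is a step upwards
  and \<open>b\<close> marks the current point \<open>(X, Y)\<close>. The class then fixes the end point of the path, the number
  of marks, and the sums of \<open>X\<close>, of \<open>Y\<close> and of \<open>X * Y\<close> over the marks, while \<open>occ ac\<close> is the area
  on one side of the path; a word has no factor \<open>ac\<close> or \<open>ca\<close> iff every corner of its path is marked.

  Two local moves of marks restrict the path of a clean word. All its inner segments have length one
  (\<open>not_clean_inner_AA\<close>), and it has at most six segments (\<open>not_clean_staircase\<close>). Moreover, the
  marks on the first segment cannot be redistributed so as to free the corner at its end, and this is
  an inequality between their number and their positions (\<open>tight_prefix\<close>). Up to exchanging
  \<open>a\<close> and \<open>c\<close>, a clean word with at least two letters \<open>a\<close> and two letters \<open>c\<close>, whose path is not a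
  single corner, therefore has a path of the form \<open>a\<^sup>+ c a c\<^sup>+\<close>, \<open>a\<^sup>+ c a c a\<^sup>+\<close> or
  \<open>a\<^sup>+ c a c a c\<^sup>+\<close> (\<open>pattern_cases\<close>). Paths with a single corner, and words with
  a single \<open>a\<close> or a single \<open>c\<close>, are dealt with directly (\<open>no_CA_invariant\<close>, \<open>one_C_invariant\<close>).

  Two clean words of one class are then compared by summing a suitable bilinear function of \<open>(X, Y)\<close>
  over their marks: the sum depends on the class only, but tightness bounds it for the one word and
  the form of the path bounds it in the other direction for the other word, unless the paths coincide
  (\<open>pattern_acac_CA\<close>, \<open>pattern_acaca_AC\<close>, \<open>pattern_acacac_counts\<close>). In one case of the first
  pattern, a word of the class with a factor \<open>ac\<close> is constructed instead
  (\<open>pattern_acac_rigid\<close>).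
\<close>

section \<open>Counting scattered subsequences\<close>

text \<open>The number of occurrences of the first word as a scattered subsequence of the second.\<close>

fun occ :: "'a list \<Rightarrow> 'a list \<Rightarrow> nat" where
  "occ [] w = 1"
| "occ (x # v) [] = 0"
| "occ (x # v) (y # w) = occ (x # v) w + (if x = y then occ v w else 0)"

lemma occ_append1: "occ [x] (u @ w) = occ [x] u + occ [x] w"
  by (induction u) auto

lemma occ_append2: "occ [x, y] (u @ w) = occ [x, y] u + occ [x] u * occ [y] w + occ [x, y] w"
  by (induction u) (auto simp: occ_append1)

lemma occ_append3:
  "occ [x, y, z] (u @ w) =
     occ [x, y, z] u + occ [x, y] u * occ [z] w + occ [x] u * occ [y, z] w + occ [x, y, z] w"
  by (induction u) (auto simp: occ_append1 occ_append2 algebra_simps)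

lemmas occ_append = occ_append1 occ_append2 occ_append3

lemma occ_eq_0: "\<not> set v \<subseteq> set w \<Longrightarrow> occ v w = 0"
  by (induction v w rule: occ.induct) auto

lemma occ_pos_iff: "0 < occ [x] w \<longleftrightarrow> x \<in> set w"
  by (induction w) auto

lemma occ_replicate1: "occ [x] (replicate n y) = (if x = y then n else 0)"
  by (induction n) auto

lemma occ_replicate2: "x \<noteq> y \<Longrightarrow> occ [x, y] (replicate n z) = 0"
  by (induction n) (auto simp: occ_replicate1)

lemma occ_replicate3: "x \<noteq> y \<Longrightarrow> y \<noteq> z \<Longrightarrow> occ [x, y, z] (replicate n t) = 0"
  by (induction n) (auto simp: occ_replicate2)

lemmas occ_replicate = occ_replicate1 occ_replicate2 occ_replicate3

lemma occ_rev1: "occ [x] (rev w) = occ [x] w"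
  by (induction w) (auto simp: occ_append)

lemma occ_rev2: "occ [x, y] (rev w) = occ [y, x] w"
  by (induction w) (auto simp: occ_append occ_rev1)

lemma occ_rev3: "occ [x, y, z] (rev w) = occ [z, y, x] w"
  by (induction w) (auto simp: occ_append occ_rev1 occ_rev2)

lemmas occ_rev = occ_rev1 occ_rev2 occ_rev3

lemma occ_map: "inj f \<Longrightarrow> occ (map f v) (map f w) = occ v w"
  by (induction v w rule: occ.induct) (auto dest: injD)

lemma occ_filter: "set v \<subseteq> S \<Longrightarrow> occ v (filter (\<lambda>x. x \<in> S) w) = occ v w"
proof (induction v w rule: occ.induct)
  case (3 x v y w)
  then show ?case by (cases "y \<in> S") auto
qed auto

lemma occ_swap2: "x \<noteq> y \<Longrightarrow> occ [x, y] w + occ [y, x] w = occ [x] w * occ [y] w"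
  by (induction w) (auto simp: algebra_simps)

text \<open>For each letter \<open>y\<close> of \<open>w\<close>, let \<open>X\<close> and \<open>Y\<close> be the numbers of \<open>x\<close> and of \<open>z\<close> before it. Both sides
  are the sum of \<open>occ z * X + occ x * Y - X * Y\<close> over the letters \<open>y\<close>. Thus the Parikh matrix
  determines \<open>occ zyx\<close>.\<close>

lemma occ_swap3:
  assumes "x \<noteq> y" "y \<noteq> z" "x \<noteq> z"
  shows "occ [z, y, x] w + occ [z] w * occ [x, y] w = occ [x] w * occ [z, y] w + occ [x, y, z] w"
proof (induction w)
  case (Cons t w)
  have "occ [z, y] w + occ [y, z] w = occ [z] w * occ [y] w"
    and "occ [x, y] w + occ [y, x] w = occ [x] w * occ [y] w"
    using occ_swap2 assms by metis+
  then show ?case using Cons assms by (auto simp: algebra_simps)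
qed auto

text \<open>Over two letters, all values of \<open>occ xy\<close> between the obvious bounds are attained.\<close>

lemma binary_word_exists:
  assumes "x \<noteq> y" "k \<le> p * q"
  obtains s where "set s \<subseteq> {x, y}" "occ [x] s = p" "occ [y] s = q" "occ [x, y] s = k"
proof -
  have "\<exists>s. set s \<subseteq> {x, y} \<and> occ [x] s = p \<and> occ [y] s = q \<and> occ [x, y] s = k"
    using assms(2)
  proof (induction p arbitrary: k)
    case 0
    then show ?case using assms(1)
      by (intro exI[of _ "replicate q y"]) (auto simp: occ_replicate)
  next
    case (Suc p)
    consider "k \<le> p * q" | "p = 0" "k \<le> q" | "q \<le> k" "k - q \<le> p * q"
      using Suc.prems by (cases p) (auto, linarith)
    then show ?case
    proof cases
      case 1
      from Suc.IH[OF this] obtain s where "set s \<subseteq> {x, y}" "occ [x] s = p" "occ [y] s = q"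
        "occ [x, y] s = k" by auto
      then show ?thesis using assms(1)
        by (intro exI[of _ "s @ [x]"]) (auto simp: occ_append)
    next
      case 2
      then show ?thesis using assms(1)
        by (intro exI[of _ "replicate (q - k) y @ x # replicate k y"])
           (auto simp: occ_append occ_replicate)
    next
      case 3
      from Suc.IH[OF this(2)] obtain s where "set s \<subseteq> {x, y}" "occ [x] s = p" "occ [y] s = q"
        "occ [x, y] s = k - q" by auto
      then show ?thesis using assms(1) 3
        by (intro exI[of _ "x # s"]) (auto)
    qed
  qed
  then show ?thesis using that by blast
qed

section \<open>Ternary words and their equivalence\<close>

text \<open>The three letters \<open>a < b < c\<close> in the abstract. The reversal of words and the exchange of \<open>a\<close> and
  \<open>c\<close> are symmetries of all the notions below.\<close>

datatype letter = A | B | C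

primrec swap :: "letter \<Rightarrow> letter" where
  "swap A = C" | "swap B = B" | "swap C = A"

lemma swap_swap [simp]: "swap (swap x) = x"
  by (cases x) auto

lemma inj_swap: "inj swap"
  by (metis injI swap_swap)

lemma map_swap_swap [simp]: "map swap (map swap w) = w"
  by (induction w) auto

lemma occ_map_swap: "occ v (map swap w) = occ (map swap v) w"
  by (metis inj_swap map_swap_swap occ_map)

text \<open>Equality of the Parikh matrices of ternary words, expressed by their entries.\<close>

definition equ :: "letter list \<Rightarrow> letter list \<Rightarrow> bool" where
  "equ w w' \<longleftrightarrow> (\<forall>v\<in>{[A], [B], [C], [A, B], [B, C], [A, B, C]}. occ v w = occ v w')"

lemma equ_refl [simp]: "equ w w"
  and equ_sym: "equ w w' \<Longrightarrow> equ w' w"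
  and equ_trans: "equ w w' \<Longrightarrow> equ w' w'' \<Longrightarrow> equ w w''"
  by (simp_all add: equ_def)

lemma equ_append: "equ u u' \<Longrightarrow> equ v v' \<Longrightarrow> equ (u @ v) (u' @ v')"
  by (auto simp: equ_def occ_append)

lemma equ_counts:
  assumes "equ w w'"
  shows "occ [A] w = occ [A] w'" "occ [B] w = occ [B] w'" "occ [C] w = occ [C] w'"
    "occ [A, B] w = occ [A, B] w'" "occ [B, C] w = occ [B, C] w'"
    "occ [B, A] w = occ [B, A] w'" "occ [C, B] w = occ [C, B] w'"
    "occ [A, B, C] w = occ [A, B, C] w'" "occ [C, B, A] w = occ [C, B, A] w'"
proof -
  show *: "occ [A] w = occ [A] w'" "occ [B] w = occ [B] w'" "occ [C] w = occ [C] w'"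
    "occ [A, B] w = occ [A, B] w'" "occ [B, C] w = occ [B, C] w'"
    "occ [A, B, C] w = occ [A, B, C] w'"
    using assms by (auto simp: equ_def)
  show ba: "occ [B, A] w = occ [B, A] w'" and cb: "occ [C, B] w = occ [C, B] w'"
    using occ_swap2[of A B w] occ_swap2[of A B w'] occ_swap2[of B C w] occ_swap2[of B C w']
    unfolding * by simp_all
  show "occ [C, B, A] w = occ [C, B, A] w'"
    using occ_swap3[of A B C w] occ_swap3[of A B C w'] unfolding * cb by simp
qed

lemma equ_map_swap: assumes "equ w w'" shows "equ (map swap w) (map swap w')"
  unfolding equ_def using equ_counts[OF assms] by (simp add: occ_map_swap)

lemma equ_rev: assumes "equ w w'" shows "equ (rev w) (rev w')"
  unfolding equ_def using equ_counts[OF assms] by (simp add: occ_rev)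

lemma equI_rev:
  assumes "occ [A] w = occ [A] w'" "occ [B] w = occ [B] w'" "occ [C] w = occ [C] w'"
    "occ [B, A] w = occ [B, A] w'" "occ [C, B] w = occ [C, B] w'"
    "occ [C, B, A] w = occ [C, B, A] w'"
  shows "equ w w'"
proof -
  have "equ (rev w) (rev w')" using assms by (simp add: equ_def occ_rev)
  from equ_rev[OF this] show ?thesis by simp
qed

text \<open>The words whose class is not trivially distinguishable.\<close>

definition clean :: "letter list \<Rightarrow> bool" where
  "clean w \<longleftrightarrow> (\<forall>w'. equ w w' \<longrightarrow> \<not> sublist [A, C] w' \<and> \<not> sublist [C, A] w')"

lemma clean_equ: "clean w \<Longrightarrow> equ w w' \<Longrightarrow> clean w'"
  unfolding clean_def using equ_trans by blast

lemma not_clean_AC: "\<not> clean (u @ A # C # v)" and not_clean_CA: "\<not> clean (u @ C # A # v)"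
proof -
  have "sublist [x, y] (u @ x # y # v)" for x y :: letter
    unfolding sublist_def by (metis append_Cons append_Nil)
  then show "\<not> clean (u @ A # C # v)" "\<not> clean (u @ C # A # v)"
    unfolding clean_def using equ_refl by blast+
qed

lemma clean_sublist: "clean w \<Longrightarrow> sublist s w \<Longrightarrow> clean s"
proof -
  assume cl: "clean w" and "sublist s w"
  then obtain u v where w: "w = u @ s @ v" by (auto simp: sublist_def)
  show "clean s"
    unfolding clean_def
  proof (intro allI impI)
    fix s' assume "equ s s'"
    then have "equ w (u @ s' @ v)" unfolding w by (intro equ_append) auto
    then have *: "\<not> sublist [A, C] (u @ s' @ v)" "\<not> sublist [C, A] (u @ s' @ v)"
      using cl by (auto simp: clean_def)
    have "sublist s' (u @ s' @ v)" by (rule sublist_appendI)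
    then show "\<not> sublist [A, C] s' \<and> \<not> sublist [C, A] s'"
      using * sublist_order.order.trans by blast
  qed
qed

lemma clean_map_swap: "clean (map swap w) \<longleftrightarrow> clean w"
proof -
  have *: "clean (map swap w)" if "clean w" for w
    unfolding clean_def
  proof (intro allI impI)
    fix w' assume "equ (map swap w) w'"
    then have "equ w (map swap w')" using equ_map_swap map_swap_swap by metis
    then show "\<not> sublist [A, C] w' \<and> \<not> sublist [C, A] w'"
      using that map_mono_sublist[of "[A, C]" w' swap] map_mono_sublist[of "[C, A]" w' swap]
      by (auto simp: clean_def)
  qed
  show ?thesis using *[of w] *[of "map swap w"] by (auto simp del: map_map)
qed

lemma clean_rev: "clean (rev w) \<longleftrightarrow> clean w"
proof -
  have *: "clean (rev w)" if "clean w" for w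
    unfolding clean_def
  proof (intro allI impI)
    fix w' assume "equ (rev w) w'"
    then have "equ w (rev w')" using equ_rev[of "rev w" w'] by simp
    then show "\<not> sublist [A, C] w' \<and> \<not> sublist [C, A] w'"
      using that sublist_rev[of "[A, C]" w'] sublist_rev[of "[C, A]" w']
      by (auto simp: clean_def)
  qed
  show ?thesis using *[of w] *[of "rev w"] by auto
qed

section \<open>Local restrictions on clean words\<close>

text \<open>If the inequality failed, the prefix \<open>s\<close> could be replaced by a word with the same counts that
  ends in \<open>A\<close>, directly before the \<open>C\<close>.\<close>

lemma tight_prefix:
  assumes "clean (s @ C # v)" "set s \<subseteq> {A, B}" "A \<in> set s"
  shows "occ [B, A] s < occ [B] s"
proof (rule ccontr)
  assume *: "\<not> ?thesis"
  obtain p where p: "occ [A] s = Suc p"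
    using assms(3) occ_pos_iff[of A s] by (cases "occ [A] s") auto
  have "occ [A, B] s \<le> p * occ [B] s"
    using occ_swap2[of A B s] * p by auto
  from binary_word_exists[OF _ this, of A B] obtain t where
    t: "set t \<subseteq> {A, B}" "occ [A] t = p" "occ [B] t = occ [B] s" "occ [A, B] t = occ [A, B] s"
    by auto
  have "C \<notin> set s" "C \<notin> set t" using assms(2) t by auto
  then have "equ s (t @ [A])"
    using p t by (auto simp: equ_def occ_append occ_eq_0)
  then have "equ (s @ C # v) (t @ A # C # v)"
    using equ_append[of s "t @ [A]" "C # v" "C # v"] by auto
  then show False using assms(1) clean_equ not_clean_AC by blast
qed

text \<open>Two letters \<open>A\<close> of one horizontal segment may move apart by one step each, by \<open>b a v a b\<close> and
  \<open>a b v b a\<close> being equivalent; repeating this makes one of them meet a \<open>C\<close>.\<close>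

lemma not_clean_inner_AA:
  assumes "set v \<subseteq> {A, B}"
  shows "\<not> clean (C # replicate i B @ A # v @ A # replicate j B @ [C])"
  using assms
proof (induction i arbitrary: j v)
  case 0
  then show ?case using not_clean_CA[of "[]"] by auto
next
  case (Suc i)
  show ?case
  proof (cases j)
    case 0
    then show ?thesis using not_clean_AC[of "C # replicate (Suc i) B @ A # v" "[]"] by auto
  next
    case (Suc j')
    have "C \<notin> set v" using Suc.prems by auto
    then have "equ (B # A # v @ [A, B]) (A # B # v @ [B, A])"
      by (auto simp: equ_def occ_append occ_eq_0)
    then have "equ ((C # replicate i B) @ (B # A # v @ [A, B]) @ (replicate j' B @ [C]))
        ((C # replicate i B) @ (A # B # v @ [B, A]) @ (replicate j' B @ [C]))"
      by (intro equ_append) auto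
    then have "equ (C # replicate (Suc i) B @ A # v @ A # replicate j B @ [C])
      (C # replicate i B @ A # (B # v @ [B]) @ A # replicate j' B @ [C])"
      using Suc by (simp add: replicate_app_Cons_same)
    moreover have "\<not> clean (C # replicate i B @ A # (B # v @ [B]) @ A # replicate j' B @ [C])"
      using Suc.IH[of "B # v @ [B]" j'] Suc.prems by auto
    ultimately show ?thesis using clean_equ by blast
  qed
qed

text \<open>With the corners \<open>(0,0)\<close>, \<open>(0,1)\<close>, \<open>(1,1)\<close>, \<open>(1,2)\<close>, \<open>(2,2)\<close>, \<open>(2,3)\<close>, one mark at each of
  \<open>(0,0)\<close>, \<open>(0,1)\<close>, \<open>(2,3)\<close> is replaced by one at each of \<open>(-1,0)\<close>, \<open>(1,2)\<close>, \<open>(2,2)\<close>. This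
  preserves the sums of \<open>X\<close>, \<open>Y\<close> and \<open>X * Y\<close>, and it can be repeated until a corner is free.\<close>

lemma not_clean_staircase:
  "\<not> clean (A # replicate i B @ C # replicate j B @ A # replicate k B @ C # replicate l B @
      A # replicate m B @ C # replicate n B @ [A])"
proof (induction i arbitrary: j k l m n)
  case 0
  then show ?case using not_clean_AC[of "[]"] by auto
next
  case (Suc i)
  show ?case (is "\<not> clean ?w")
  proof
    assume cl: "clean ?w"
    obtain j' where j: "j = Suc j'"
      using cl not_clean_CA[of "A # replicate (Suc i) B"] by (cases j) auto
    obtain n' where n: "n = Suc n'"
      using cl not_clean_CA[of "A # replicate (Suc i) B @ C # replicate j B @ A # replicate k B @
        C # replicate l B @ A # replicate m B" "[]"] by (cases n) auto
    let ?v = "A # replicate i B @ C # replicate j' B @ A # replicate k B @ C # replicate (Suc l) B @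
      A # replicate (Suc m) B @ C # replicate n' B @ [A]"
    have "equ ?w (B # ?v)"
      unfolding j n equ_def by (auto simp: occ_append occ_replicate algebra_simps)
    then have "clean (B # ?v)" using cl clean_equ by blast
    then have "clean ?v" by (rule clean_sublist) (metis append_Cons append_Nil sublist_append_leftI)
    then show False using Suc by blast
  qed
qed


lemma letters_AB: "set s \<subseteq> {A, B} \<longleftrightarrow> C \<notin> set s"
  and letters_BC: "set s \<subseteq> {B, C} \<longleftrightarrow> A \<notin> set s"
  using letter.exhaust by auto

lemma letters_B: "A \<notin> set s \<Longrightarrow> C \<notin> set s \<Longrightarrow> s = replicate (length s) B"
  by (metis letter.exhaust replicate_length_same)

text \<open>Reversal combined with the exchange of \<open>A\<close> and \<open>C\<close>. It preserves \<open>occ ac\<close> and turns a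
  suffix preceded by \<open>A\<close> into a prefix followed by \<open>C\<close>.\<close>

definition flip :: "letter list \<Rightarrow> letter list" where
  "flip w = map swap (rev w)"

lemma flip_simps:
  "flip [] = []" "flip (x # w) = flip w @ [swap x]" "flip (u @ w) = flip w @ flip u"
  "flip (replicate n x) = replicate n (swap x)"
  by (auto simp: flip_def)

lemma clean_flip: "clean (flip w) \<longleftrightarrow> clean w"
  by (simp add: flip_def clean_map_swap clean_rev)

lemma equ_flip: "equ w w' \<Longrightarrow> equ (flip w) (flip w')"
  by (simp add: flip_def equ_map_swap equ_rev)

lemma occ_flip:
  "occ [x] (flip w) = occ [swap x] w"
  "occ [x, y] (flip w) = occ [swap y, swap x] w"
  by (simp_all add: flip_def occ_map_swap occ_rev)

lemma set_flip: "x \<in> set (flip w) \<longleftrightarrow> swap x \<in> set w"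
  by (force simp: flip_def image_iff)

lemma tight_suffix:
  assumes "clean (v @ A # t)" "set t \<subseteq> {B, C}" "C \<in> set t"
  shows "occ [C, B] t < occ [B] t"
proof -
  have "clean (flip (v @ A # t))" using assms(1) by (simp add: clean_flip)
  then have "clean (flip t @ C # flip v)" by (simp add: flip_simps)
  moreover have "set (flip t) \<subseteq> {A, B}"
    using assms(2) by (simp add: letters_AB letters_BC set_flip)
  ultimately have "occ [B, A] (flip t) < occ [B] (flip t)"
    using tight_prefix assms(3) by (simp add: set_flip)
  then show ?thesis by (simp add: occ_flip)
qed

text \<open>An \<open>A\<close> that lies between two letters \<open>C\<close> is a horizontal segment of its own.\<close>

lemma inner_single_A:
  assumes "clean (u @ C # replicate i B @ A # v)" "C \<in> set v"
  obtains j v' where "v = replicate (Suc j) B @ C # v'"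
proof -
  from split_list_first[OF assms(2)] obtain p q where v: "v = p @ C # q" "C \<notin> set p"
    by auto
  show ?thesis
  proof (cases "A \<in> set p")
    case True
    from split_list_last[OF this] obtain p1 p2 where p: "p = p1 @ A # p2" "A \<notin> set p2"
      by auto
    have p2: "p2 = replicate (length p2) B" using v p by (intro letters_B) auto
    have p1: "set p1 \<subseteq> {A, B}" using v p by (simp add: letters_AB)
    let ?s = "C # replicate i B @ A # p1 @ A # replicate (length p2) B @ [C]"
    have "u @ C # replicate i B @ A # v = u @ ?s @ q" unfolding v p using p2 by simp
    then have "clean ?s" using assms(1) clean_sublist sublist_appendI by metis
    then show ?thesis using not_clean_inner_AA[OF p1] by blast
  next
    case False
    then have p: "p = replicate (length p) B" using v by (intro letters_B)
    show ?thesis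
    proof (cases "length p")
      case 0
      then have "\<not> clean (u @ C # replicate i B @ A # v)"
        using not_clean_AC[of "u @ C # replicate i B" q] v by auto
      then show ?thesis using assms(1) by blast
    next
      case (Suc j)
      then show ?thesis using that[of j q] p v by auto
    qed
  qed
qed

lemma inner_single_C:
  assumes "clean (u @ A # replicate i B @ C # v)" "A \<in> set v"
  obtains j v' where "v = replicate (Suc j) B @ A # v'"
proof -
  have "clean (map swap u @ C # replicate i B @ A # map swap v)"
    using assms(1) clean_map_swap[of "u @ A # replicate i B @ C # v"] by simp
  moreover have "C \<in> set (map swap v)" using assms(2) by force
  ultimately obtain j v' where "map swap v = replicate (Suc j) B @ C # v'"
    by (rule inner_single_A)
  then have "v = map swap (replicate (Suc j) B @ C # v')" by (metis map_swap_swap)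
  then show ?thesis using that[of j "map swap v'"] by simp
qed

section \<open>The patterns of clean words\<close>

text \<open>The words whose path, read without the letters \<open>B\<close>, is of the form \<open>a\<^sup>+ c a c\<^sup>+\<close>,
  \<open>a\<^sup>+ c a c a\<^sup>+\<close> and \<open>a\<^sup>+ c a c a c\<^sup>+\<close>, respectively. Marked corners are required where this
  is used later.\<close>

definition pattern_acac :: "letter list \<Rightarrow> bool" where
  "pattern_acac w \<longleftrightarrow> (\<exists>s g t. w = s @ C # replicate (Suc g) B @ A # t \<and>
     set s \<subseteq> {A, B} \<and> A \<in> set s \<and> set t \<subseteq> {B, C} \<and> C \<in> set t)"

definition pattern_acaca :: "letter list \<Rightarrow> bool" where
  "pattern_acaca w \<longleftrightarrow> (\<exists>s i j t. w = s @ C # replicate i B @ A # replicate j B @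
       C # t \<and>
     set s \<subseteq> {A, B} \<and> A \<in> set s \<and> set t \<subseteq> {A, B} \<and> A \<in> set t)"

definition pattern_acacac :: "letter list \<Rightarrow> bool" where
  "pattern_acacac w \<longleftrightarrow> (\<exists>s i j k t. w = s @ C # replicate (Suc i) B @ A # replicate (Suc j) B @
       C # replicate (Suc k) B @ A # t \<and>
     set s \<subseteq> {A, B} \<and> A \<in> set s \<and> set t \<subseteq> {B, C} \<and> C \<in> set t)"

lemma pattern_if_A_first:
  assumes cl: "clean (s @ C # v)" and s: "set s \<subseteq> {A, B}" "A \<in> set s"
    and "A \<in> set v" "C \<in> set v"
  shows "pattern_acac (s @ C # v) \<or> pattern_acaca (s @ C # v) \<or> pattern_acacac (s @ C # v)"
proof -
  from split_list_last[OF s(2)] obtain s0 s1 where s01: "s = s0 @ A # s1" "A \<notin> set s1"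
    by auto
  define h where "h = length s1"
  have "s1 = replicate h B" unfolding h_def using s01 s by (intro letters_B) (auto simp: letters_AB)
  then have s0: "s = s0 @ A # replicate h B" using s01 by simp
  from inner_single_C[of s0 h v] cl \<open>A \<in> set v\<close> obtain i v2
    where v: "v = replicate (Suc i) B @ A # v2" unfolding s0 by auto
  have C2: "C \<in> set v2" using \<open>C \<in> set v\<close> v by auto
  show ?thesis
  proof (cases "A \<in> set v2")
    case False
    then have "pattern_acac (s @ C # v)" unfolding pattern_acac_def v
      using s C2 letters_BC by blast
    then show ?thesis by blast
  next
    case True
    from inner_single_A[of "s" "Suc i" v2] cl C2 obtain j v3
      where v2: "v2 = replicate (Suc j) B @ C # v3" unfolding v by auto
    have "A \<in> set v3" using True v2 by auto
    with inner_single_C[of "s @ C # replicate (Suc i) B" "Suc j" v3] cl obtain k v4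
      where v3: "v3 = replicate (Suc k) B @ A # v4" unfolding v v2 by auto
    consider "C \<notin> set v4" | "C \<in> set v4" "A \<notin> set v4" | "C \<in> set v4" "A \<in> set v4"
      by blast
    then show ?thesis
    proof cases
      case 1
      then have "set v3 \<subseteq> {A, B}" using v3 by (simp add: letters_AB)
      then have "pattern_acaca (s @ C # v)" unfolding pattern_acaca_def v v2
        using s \<open>A \<in> set v3\<close> by blast
      then show ?thesis by blast
    next
      case 2
      then have "pattern_acacac (s @ C # v)" unfolding pattern_acacac_def v v2 v3
        using s letters_BC by blast
      then show ?thesis by blast
    next
      case 3
      from inner_single_A[of "s @ C # replicate (Suc i) B @ A # replicate (Suc j) B" "Suc k" v4]
        cl 3(1) obtain l v5 where v4: "v4 = replicate (Suc l) B @ C # v5"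
        unfolding v v2 v3 by auto
      have "A \<in> set v5" using 3(2) v4 by auto
      with inner_single_C[of "s @ C # replicate (Suc i) B @ A # replicate (Suc j) B @
          C # replicate (Suc k) B" "Suc l" v5] cl
      obtain m v6 where v5: "v5 = replicate (Suc m) B @ A # v6"
        unfolding v v2 v3 v4 by auto
      let ?f = "A # replicate h B @ C # replicate (Suc i) B @ A # replicate (Suc j) B @
        C # replicate (Suc k) B @ A # replicate (Suc l) B @ C # replicate (Suc m) B @ [A]"
      have "s @ C # v = s0 @ ?f @ v6" unfolding s0 v v2 v3 v4 v5 by simp
      then have "clean ?f" using cl clean_sublist sublist_appendI by metis
      then show ?thesis using not_clean_staircase by blast
    qed
  qed
qed

lemma pattern_cases:
  assumes "clean w" "0 < occ [C, A] w" "0 < occ [A, C] w" "2 \<le> occ [A] w" "2 \<le> occ [C] w"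
  obtains "pattern_acac w" | "pattern_acaca w" | "pattern_acacac w"
    | "pattern_acac (map swap w)" | "pattern_acaca (map swap w)" | "pattern_acacac (map swap w)"
proof -
  have main: "pattern_acac w \<or> pattern_acaca w \<or> pattern_acacac w"
    if w: "w = s @ C # v" and cl: "clean w" and C: "C \<notin> set s" "A \<in> set s"
      and occ: "0 < occ [C, A] w" "2 \<le> occ [C] w" for w s v
  proof -
    have *: "occ [C] w = Suc (occ [C] v)" "occ [C, A] w = occ [A] v + occ [C, A] v"
      using C unfolding w by (auto simp: occ_append occ_eq_0)
    have "C \<in> set v" using * occ occ_pos_iff[of C v] by auto
    moreover have "A \<in> set v"
      using * occ occ_pos_iff[of A v] occ_eq_0[of "[C, A]" v] by fastforce
    ultimately show ?thesis
      using pattern_if_A_first cl C unfolding w by (auto simp: letters_AB)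
  qed
  have "C \<in> set w" using assms(5) occ_pos_iff[of C w] by auto
  from split_list_first[OF this] obtain s v where w: "w = s @ C # v" "C \<notin> set s" by auto
  have "pattern_acac w \<or> pattern_acaca w \<or> pattern_acacac w \<or>
    pattern_acac (map swap w) \<or> pattern_acaca (map swap w) \<or> pattern_acacac (map swap w)"
  proof (cases "A \<in> set s")
    case True
    then show ?thesis using main[OF w(1)] w assms by blast
  next
    case False
    have "A \<in> set w" using assms(4) occ_pos_iff[of A w] by auto
    then have "A \<in> set v" using w False by auto
    from split_list_first[OF this] obtain p q where v: "v = p @ A # q" "A \<notin> set p" by auto
    have 1: "map swap w = (map swap s @ A # map swap p) @ C # map swap q" using w v by simp
    have 2: "C \<notin> set (map swap s @ A # map swap p)"
      using False v by (auto simp: image_iff) (metis swap.simps(1) swap_swap swap.simps(3))+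
    have 3: "clean (map swap w)" "0 < occ [C, A] (map swap w)" "2 \<le> occ [C] (map swap w)"
      using assms by (simp_all add: clean_map_swap occ_map_swap)
    have "A \<in> set (map swap s @ A # map swap p)" by simp
    from main[OF 1 3(1) 2 this 3(2,3)] show ?thesis by blast
  qed
  then show ?thesis using that by blast
qed

section \<open>Invariance of the number of subsequences ac\<close>

text \<open>The paths with at most one corner are settled by \<open>occ cba\<close>, an invariant of the class.\<close>

lemma occ_CA_eq_0:
  assumes "clean w" "occ [C, B, A] w = 0"
  shows "occ [C, A] w = 0"
proof (cases "C \<in> set w")
  case True
  from split_list_first[OF True] obtain s v where w: "w = s @ C # v" "C \<notin> set s" by auto
  show ?thesis
  proof (cases "A \<in> set v")
    case True
    from split_list_first[OF this] obtain p q where v: "v = p @ A # q" "A \<notin> set p" by auto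
    have "C \<in> set (C # p)" by simp
    from split_list_last[OF this] obtain p1 p2 where p: "C # p = p1 @ C # p2" "C \<notin> set p2"
      by metis
    have w2: "w = s @ p1 @ C # p2 @ A # q" using w v p by (metis append_Cons append_assoc)
    have "set p2 \<subseteq> set p" using p by (cases p1) auto
    then have p2: "p2 = replicate (length p2) B" using p v by (intro letters_B) auto
    have "p2 \<noteq> []" using assms(1) not_clean_CA[of "s @ p1" q] unfolding w2 by auto
    then have "B \<in> set p2" using p2 by (metis in_set_replicate length_0_conv)
    then have "0 < occ [B] p2" by (simp add: occ_pos_iff)
    then have "0 < occ [C, B, A] w" unfolding w2 by (simp add: occ_append)
    then show ?thesis using assms(2) by simp
  next
    case False
    then show ?thesis using w by (simp add: occ_append occ_eq_0)
  qed
qed (simp add: occ_eq_0)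

lemma occ_drop_middle_eq_0: "occ [x, z] w = 0 \<Longrightarrow> occ [x, y, z] w = 0"
proof (induction w)
  case (Cons t w)
  then show ?case using occ_pos_iff[of z w] occ_eq_0[of "[y, z]" w] by (auto split: if_splits)
qed auto

lemma no_CA_invariant:
  assumes "equ w w'" "clean w'" "occ [C, A] w = 0"
  shows "occ [C, A] w' = 0"
  using assms occ_CA_eq_0 occ_drop_middle_eq_0 equ_counts(9) by metis

text \<open>With a single \<open>C\<close>, the class determines the number of letters \<open>B\<close> before it and the sum of
  their \<open>X\<close>. If the \<open>C\<close> of \<open>w'\<close> came earlier, this sum would be too small for the tightness of \<open>w\<close>.\<close>

lemma one_C_invariant:
  assumes "clean w" "equ w w'" "occ [C] w = 1"
  shows "occ [A, C] w = occ [A, C] w'"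
proof -
  have main: "occ [A, C] w \<le> occ [A, C] w'" if cl: "clean w" "equ w w'" "occ [C] w = 1" for w w'
  proof (rule ccontr)
    assume less: "\<not> ?thesis"
    have C': "occ [C] w' = 1" using equ_counts(3)[OF cl(2)] cl(3) by simp
    have "C \<in> set w" "C \<in> set w'" using cl(3) C' occ_pos_iff[of C w] occ_pos_iff[of C w'] by auto
    then obtain s t s' t' where w: "w = s @ C # t" "C \<notin> set s" and w': "w' = s' @ C # t'" "C \<notin> set s'"
      using split_list_first by metis
    have "occ [C] t = 0" "occ [C] t' = 0" using cl(3) C' w w' by (auto simp: occ_append)
    then have t: "C \<notin> set t" "C \<notin> set t'" using occ_pos_iff[of C] by (metis less_numeral_extra(3))+
    have eq: "occ [B] s = occ [B] s'" "occ [A, B] s = occ [A, B] s'"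
      using equ_counts(5)[OF cl(2)] equ_counts(8)[OF cl(2)] w w' t by (auto simp: occ_append occ_eq_0)
    have "occ [A] s' < occ [A] s" using less w w' t by (auto simp: occ_append occ_eq_0)
    then obtain p where p: "occ [A] s = Suc p" "occ [A] s' \<le> p" by (cases "occ [A] s") auto
    have "A \<in> set s" using p occ_pos_iff[of A s] by auto
    then have "occ [B, A] s < occ [B] s"
      using tight_prefix[of s t] cl w by (simp add: letters_AB)
    then have "p * occ [B] s < occ [A, B] s" using occ_swap2[of A B s] p by auto
    moreover have "occ [A, B] s' \<le> occ [A] s' * occ [B] s'" using occ_swap2[of A B s'] by auto
    moreover have "occ [A] s' * occ [B] s' \<le> p * occ [B] s'" using p by simp
    ultimately show False using eq by simp
  qed
  have "clean w'" "equ w' w" "occ [C] w' = 1"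
    using assms clean_equ equ_sym equ_counts(3)[OF assms(2)] by auto
  then show ?thesis using main[OF assms] main[of w' w] by simp
qed

lemma one_A_invariant:
  assumes "clean w" "equ w w'" "occ [A] w = 1"
  shows "occ [A, C] w = occ [A, C] w'"
  using one_C_invariant[of "flip w" "flip w'"] assms
  by (simp add: clean_flip equ_flip occ_flip)

text \<open>Suppose that the part of \<open>w'\<close> between its first \<open>C\<close> and its last \<open>A\<close> contains an \<open>A\<close>, but no
  further \<open>C\<close>. Then the marks of \<open>w'\<close> before its first \<open>C\<close> have distance at least two from the right
  border, so that there are fewer of them than in \<open>w\<close>, although the sum of the distances is the same.
  With the number taken from \<open>w'\<close> and the other data from \<open>w\<close>, the corner before the first \<open>C\<close> of
  \<open>w\<close> can be freed.\<close>

lemma pattern_acac_rigid: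
  assumes cl: "clean w" and eq: "equ w w'"
    and w: "w = s @ C # replicate g B @ A # t" "set s \<subseteq> {A, B}" "A \<in> set s" "set t \<subseteq> {B, C}"
    and w': "w' = s' @ C # m @ A # t'" "set s' \<subseteq> {A, B}" "set m \<subseteq> {A, B}" "set t' \<subseteq> {B, C}"
    and A_m: "A \<in> set m"
  shows False
proof -
  have notin: "C \<notin> set s" "A \<notin> set t" "C \<notin> set s'" "C \<notin> set m" "A \<notin> set t'"
    using w w' by (auto simp: letters_AB letters_BC)
  note counts = equ_counts[OF eq, unfolded w w']
  have a: "occ [A] s = occ [A] s' + occ [A] m"
    and b: "occ [B] s + g + occ [B] t = occ [B] s' + occ [B] m + occ [B] t'"
    and c: "occ [C] t = occ [C] t'"
    and cba: "g = occ [B, A] m + occ [B] m"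
    using counts notin by (auto simp: occ_append occ_replicate occ_eq_0)
  have ba: "occ [B, A] s + occ [B] s = occ [B, A] s' + occ [B] s' * occ [A] m + occ [B] s'"
    using counts(6) notin cba by (auto simp: occ_append occ_replicate occ_eq_0)
  have cb: "g + occ [B] t + occ [C, B] t = occ [B] m + occ [B] t' + occ [C, B] t'"
    using counts(7) notin by (auto simp: occ_append occ_replicate occ_eq_0)
  have tight: "occ [B, A] s < occ [B] s" using tight_prefix cl w by blast
  have m1: "1 \<le> occ [A] m" using A_m occ_pos_iff[of A m] by (simp add: Suc_le_eq)
  then have "occ [B] s' * 1 \<le> occ [B] s' * occ [A] m" by (intro mult_left_mono) auto
  then have r2: "2 * occ [B] s' \<le> occ [B, A] s + occ [B] s" using ba by linarith
  then have r': "occ [B] s' < occ [B] s" using tight by linarith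
  have "occ [A] s \<noteq> 0" using a m1 by simp
  then obtain p where p: "occ [A] s = Suc p" using not0_implies_Suc by blast
  have "occ [B, A] s' \<le> occ [A] s' * occ [B] s'" using occ_swap2[of A B s'] by simp
  then have "occ [B, A] s + occ [B] s \<le> (p + 2) * occ [B] s'"
    unfolding ba using a p by (simp add: algebra_simps flip: distrib_left) (simp add: algebra_simps)
  then have le: "occ [B, A] s + occ [B] s - 2 * occ [B] s' \<le> occ [B] s' * p"
    using r2 by (simp add: algebra_simps)
  from binary_word_exists[of B A, OF _ le] obtain s2 where
    s2: "set s2 \<subseteq> {B, A}" "occ [B] s2 = occ [B] s'" "occ [A] s2 = p"
      "occ [B, A] s2 = occ [B, A] s + occ [B] s - 2 * occ [B] s'" by auto
  \<comment> \<open>The letters \<open>B\<close> removed from the first segment are added to the last one.\<close>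
  define u where "u = occ [B] s + occ [B] t - occ [B] s'"
  have cb': "occ [C, B] t' + occ [B] s = occ [C, B] t + occ [B] s'" using cb b by linarith
  have "occ [C, B] t \<le> occ [C] t * occ [B] t" using occ_swap2[of C B t] by simp
  also have "\<dots> \<le> occ [C] t * u" unfolding u_def using r' by (intro mult_left_mono) auto
  finally have "occ [C, B] t' \<le> occ [C] t * u" using cb' r' by linarith
  from binary_word_exists[of C B, OF _ this] obtain t2 where
    t2: "set t2 \<subseteq> {C, B}" "occ [C] t2 = occ [C] t" "occ [B] t2 = u" "occ [C, B] t2 = occ [C, B] t'"
    by auto
  have notin2: "C \<notin> set s2" "A \<notin> set t2" using s2 t2 by auto
  have "equ w (s2 @ A # C # replicate g B @ A # t2)"
    unfolding w(1)
    using notin notin2 s2 t2 p r' r2 cb' u_def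
    by (intro equI_rev) (auto simp: occ_append occ_replicate occ_eq_0)
  then show False using cl clean_equ not_clean_AC by blast
qed

lemma pattern_acac_CA:
  assumes cl: "clean w" and eq: "equ w w'" and "pattern_acac w"
  shows "occ [C, A] w' = 1"
proof -
  from assms(3) obtain s g t where w: "w = s @ C # replicate (Suc g) B @ A # t"
    "set s \<subseteq> {A, B}" "A \<in> set s" "set t \<subseteq> {B, C}" "C \<in> set t" unfolding pattern_acac_def by blast
  have "0 < occ [C, B, A] w" unfolding w(1) by (simp add: occ_append)
  then have cba: "0 < occ [C, B, A] w'" using equ_counts(9)[OF eq] by simp
  then have "C \<in> set w'" using occ_eq_0[of "[C, B, A]" w'] by auto
  from split_list_first[OF this] obtain s' v where w': "w' = s' @ C # v" "C \<notin> set s'" by auto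
  have "A \<in> set v"
    using cba w'(2) occ_eq_0[of "[B, A]" v] occ_eq_0[of "[C, B, A]" v] unfolding w'(1)
    by (fastforce simp: occ_append occ_eq_0)
  from split_list_last[OF this] obtain m t' where v: "v = m @ A # t'" "A \<notin> set t'" by auto
  have s': "set s' \<subseteq> {A, B}" and t': "set t' \<subseteq> {B, C}"
    using w' v by (auto simp: letters_AB letters_BC)
  have w'': "w' = s' @ C # m @ A # t'" using w' v by simp
  have noA: False if "A \<in> set m" "C \<notin> set m"
    using pattern_acac_rigid[OF cl eq w(1-4) w'' s' _ t'] that by (auto simp: letters_AB)
  \<comment> \<open>The pattern is invariant under \<open>flip\<close>.\<close>
  have noC: False if "C \<in> set m" "A \<notin> set m"
  proof (rule pattern_acac_rigid)
    show "clean (flip w)" "equ (flip w) (flip w')" using cl eq by (simp_all add: clean_flip equ_flip)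
    show "flip w = flip t @ C # replicate (Suc g) B @ A # flip s"
      unfolding w(1) by (simp add: flip_simps replicate_append_same)
    show "flip w' = flip t' @ C # flip m @ A # flip s'" unfolding w'' by (simp add: flip_simps)
  qed (use w s' t' that in \<open>auto simp: letters_AB letters_BC set_flip\<close>)
  \<comment> \<open>With \<open>X'\<close> the distance from the right border, the sum of \<open>X' + Y - 2\<close> over the marks is
    negative for \<open>w\<close> and nonnegative for \<open>w'\<close>.\<close>
  have noAC: False if "A \<in> set m" "C \<in> set m"
  proof -
    have notin: "C \<notin> set s" "A \<notin> set t" "C \<notin> set s'" "A \<notin> set t'"
      using w s' t' by (auto simp: letters_AB letters_BC)
    have tight: "occ [B, A] s < occ [B] s" "occ [C, B] t < occ [B] t"
      using tight_prefix[of s "replicate (Suc g) B @ A # t"]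
        tight_suffix[of "s @ C # replicate (Suc g) B" t] cl w by auto
    then have "occ [B, A] w + occ [C, B] w < 2 * occ [B] w"
      unfolding w(1) using notin by (simp add: occ_append occ_replicate occ_eq_0)
    moreover have "occ [B] s' * 1 \<le> occ [B] s' * occ [A] m" "1 * occ [B] t' \<le> occ [C] m * occ [B] t'"
      using that occ_pos_iff[of A m] occ_pos_iff[of C m] by (intro mult_left_mono mult_right_mono; simp)+
    moreover have "occ [B, A] w' =
        occ [B, A] s' + occ [B] s' * occ [A] m + occ [B] s' + occ [B, A] m + occ [B] m"
      "occ [C, B] w' =
        occ [B] m + occ [C, B] m + occ [C] m * occ [B] t' + occ [B] t' + occ [C, B] t'"
      "occ [B] w' = occ [B] s' + occ [B] m + occ [B] t'"
      unfolding w'' using notin by (simp_all add: occ_append occ_eq_0)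
    ultimately have "2 * occ [B] w' \<le> occ [B, A] w' + occ [C, B] w'"
      and "occ [B, A] w + occ [C, B] w < 2 * occ [B] w" by linarith+
    then show False using equ_counts[OF eq] by simp
  qed
  have "A \<notin> set m" "C \<notin> set m" using noA noC noAC by auto
  then show ?thesis unfolding w'' using w' v by (simp add: occ_append occ_eq_0)
qed

text \<open>Let \<open>\<alpha>\<close> be the number of \<open>A\<close> before the first \<open>C\<close> of \<open>w\<close>. The sum of \<open>Y * (X - \<alpha> - 1)\<close> over
  the marks depends on the class only. For \<open>w\<close> it is less than twice the number of marks on the last
  segment, by tightness; for \<open>w'\<close>, whose path turns upwards later, it is at least twice that number.\<close>

lemma pattern_acaca_last_segment:
  assumes cl: "clean w" and eq: "equ w w'"
    and w: "w = s @ C # replicate i B @ A # replicate j B @ C # t"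
      "set s \<subseteq> {A, B}" "set t \<subseteq> {A, B}" "A \<in> set t"
    and w': "w' = s' @ C # replicate i' B @ A # replicate j' B @ C # t'"
      "set s' \<subseteq> {A, B}" "set t' \<subseteq> {A, B}"
    and less: "occ [A] t' < occ [A] t"
  shows "occ [B] t' < occ [B] t"
proof -
  have notin: "C \<notin> set s" "C \<notin> set t" "C \<notin> set s'" "C \<notin> set t'"
    using w w' by (auto simp: letters_AB)
  have "clean (rev t @ C # rev (s @ C # replicate i B @ A # replicate j B))"
    using cl clean_rev[of w] unfolding w(1) by simp
  from tight_prefix[OF this] have tight: "occ [A, B] t < occ [B] t"
    using w by (simp add: occ_rev)
  \<comment> \<open>The sum of \<open>Y * (X - \<alpha> - 1)\<close> is \<open>\<kappa> * occ cb - occ cba\<close>.\<close>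
  define \<kappa> where "\<kappa> = occ [A] t"
  have "\<kappa> * occ [C, B] w + i = occ [C, B, A] w + 2 * (\<kappa> * occ [B] t - occ [B, A] t)"
    unfolding w(1) \<kappa>_def using notin occ_swap2[of A B t]
    by (simp add: occ_append occ_replicate occ_eq_0 algebra_simps)
  moreover have "\<kappa> * occ [B] t - occ [B, A] t = occ [A, B] t"
    unfolding \<kappa>_def using occ_swap2[of A B t] by simp
  moreover have "occ [C, B, A] w' + 2 * occ [B] t' \<le> \<kappa> * occ [C, B] w'"
  proof -
    obtain d where d: "\<kappa> = Suc (occ [A] t' + d)"
      unfolding \<kappa>_def using less less_iff_Suc_add by auto
    have "occ [B, A] t' \<le> occ [A] t' * occ [B] t'" using occ_swap2[of A B t'] by simp
    then show ?thesis
      unfolding w'(1) d using notin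
      by (simp add: occ_append occ_replicate occ_eq_0 algebra_simps)
  qed
  ultimately show ?thesis using equ_counts(7,9)[OF eq] tight by simp
qed

text \<open>If the areas differed, one of the words would have fewer marks on the last segment than the other, but, by reversal,
  more on the first one. The numbers of marks on the three rows, however, have a fixed sum and a fixed
  first moment.\<close>

lemma pattern_acaca_AC:
  assumes "clean w" "equ w w'" "pattern_acaca w" "pattern_acaca w'"
  shows "occ [A, C] w = occ [A, C] w'"
proof -
  have main: "occ [A, C] w' \<le> occ [A, C] w"
    if cl: "clean w" and eq: "equ w w'" and sh: "pattern_acaca w" "pattern_acaca w'" for w w'
  proof (rule ccontr)
    assume less: "\<not> ?thesis"
    from sh obtain s i j t s' i' j' t' where
      w: "w = s @ C # replicate i B @ A # replicate j B @ C # t"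
        "set s \<subseteq> {A, B}" "set t \<subseteq> {A, B}" "A \<in> set s" "A \<in> set t" and
      w': "w' = s' @ C # replicate i' B @ A # replicate j' B @ C # t'"
        "set s' \<subseteq> {A, B}" "set t' \<subseteq> {A, B}" "A \<in> set s'" "A \<in> set t'"
      unfolding pattern_acaca_def by (elim exE conjE)
    have cl': "clean w'" using cl eq clean_equ by blast
    have notin: "C \<notin> set s" "C \<notin> set t" "C \<notin> set s'" "C \<notin> set t'"
      using w w' by (auto simp: letters_AB)
    have s: "occ [A] s < occ [A] s'"
      using less notin unfolding w(1) w'(1) by (simp add: occ_append occ_replicate occ_eq_0)
    have "occ [A] s + occ [A] t = occ [A] s' + occ [A] t'"
      using equ_counts(1)[OF eq] unfolding w(1) w'(1) by (simp add: occ_append occ_replicate)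
    then have "occ [A] t' < occ [A] t" using s by linarith
    then have 1: "occ [B] t' < occ [B] t"
      using pattern_acaca_last_segment[OF cl eq w(1-3,5) w'(1-3)] by blast
    have 2: "occ [B] (rev s) < occ [B] (rev s')"
    proof (rule pattern_acaca_last_segment)
      show "clean (rev w')" "equ (rev w') (rev w)"
        using cl' eq by (simp_all add: clean_rev equ_rev equ_sym)
      show "rev w' = rev t' @ C # replicate j' B @ A # replicate i' B @ C # rev s'"
        "rev w = rev t @ C # replicate j B @ A # replicate i B @ C # rev s"
        unfolding w(1) w'(1) by simp_all
    qed (use w w' s in \<open>simp_all add: occ_rev\<close>)
    have "i + j + 2 * occ [B] t = i' + j' + 2 * occ [B] t'"
      "occ [B] s + i + j + occ [B] t = occ [B] s' + i' + j' + occ [B] t'"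
      using equ_counts(2,7)[OF eq] notin unfolding w(1) w'(1)
      by (simp_all add: occ_append occ_replicate occ_eq_0)
    then show False using 1 2 by (simp add: occ_rev)
  qed
  show ?thesis
    using main[OF assms] main[OF clean_equ[OF assms(1,2)] equ_sym[OF assms(2)] assms(4,3)] by simp
qed

text \<open>With \<open>X'\<close> the distance from the right border, the sum of \<open>X' + Y - 3\<close> over the marks has
  opposite signs for this pattern and for the one obtained by exchanging \<open>A\<close> and \<open>C\<close>, so that they
  do not occur in one class.\<close>

lemma pattern_acacac_counts:
  assumes "clean w" "pattern_acacac w"
  shows "occ [C, A] w = 3" "occ [B, A] w + occ [C, B] w < 3 * occ [B] w"
proof -
  from assms(2) obtain s i j k t where
    w: "w = s @ C # replicate (Suc i) B @ A # replicate (Suc j) B @ C # replicate (Suc k) B @ A # t"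
      "set s \<subseteq> {A, B}" "A \<in> set s" "set t \<subseteq> {B, C}" "C \<in> set t"
    unfolding pattern_acacac_def by (elim exE conjE)
  have notin: "C \<notin> set s" "A \<notin> set t" using w by (auto simp: letters_AB letters_BC)
  show "occ [C, A] w = 3"
    unfolding w(1) using notin by (simp add: occ_append occ_replicate occ_eq_0)
  have "occ [B, A] s < occ [B] s" "occ [C, B] t < occ [B] t"
    using assms(1) w tight_prefix[of s] tight_suffix[of "s @ C # replicate (Suc i) B @ A #
      replicate (Suc j) B @ C # replicate (Suc k) B" t] by auto
  then show "occ [B, A] w + occ [C, B] w < 3 * occ [B] w"
    unfolding w(1) using notin by (simp add: occ_append occ_replicate occ_eq_0)
qed

lemma pattern_acacac_swap_counts:
  assumes "pattern_acacac (map swap w)"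
  shows "3 * occ [B] w \<le> occ [B, A] w + occ [C, B] w"
proof -
  from assms obtain s i j k t where
    w: "map swap w = s @ C # replicate (Suc i) B @ A # replicate (Suc j) B @
        C # replicate (Suc k) B @ A # t"
      "set s \<subseteq> {A, B}" "A \<in> set s" "set t \<subseteq> {B, C}" "C \<in> set t"
    unfolding pattern_acacac_def by (elim exE conjE)
  have notin: "C \<notin> set s" "A \<notin> set t" using w by (auto simp: letters_AB letters_BC)
  obtain p q where p: "occ [A] s = Suc p" and q: "occ [C] t = Suc q"
    using w occ_pos_iff[of A s] occ_pos_iff[of C t] by (auto simp: gr0_conv_Suc)
  have "3 * occ [B] (map swap w) \<le> occ [B, C] (map swap w) + occ [A, B] (map swap w)"
    unfolding w(1) using notin p q
    by (simp add: occ_append occ_replicate occ_eq_0 algebra_simps)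
  then show ?thesis by (simp add: occ_map_swap)
qed

lemma pattern_letters:
  "pattern_acaca w \<Longrightarrow> occ [C] w = 2 \<and> 3 \<le> occ [A] w"
  "pattern_acacac w \<Longrightarrow> 3 \<le> occ [C] w \<and> 3 \<le> occ [A] w"
  unfolding pattern_acaca_def pattern_acacac_def
  by (auto simp: occ_append occ_replicate occ_eq_0 letters_AB letters_BC Suc_le_eq
      simp flip: occ_pos_iff)

lemma clean_AC_invariant:
  assumes cl: "clean w" and eq: "equ w w'"
  shows "occ [A, C] w = occ [A, C] w'"
proof -
  note counts = equ_counts[OF eq]
  have cl': "clean w'" using clean_equ cl eq by blast
  have sw: "clean (map swap w)" "clean (map swap w')" "equ (map swap w) (map swap w')"
    "equ (map swap w') (map swap w)"
    using cl cl' eq by (simp_all add: clean_map_swap equ_map_swap equ_sym)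
  \<comment> \<open>Hence it does not matter whether \<open>occ ac\<close> or \<open>occ ca\<close> is compared.\<close>
  have AC_CA: "occ [A, C] w + occ [C, A] w = occ [A] w * occ [C] w"
    "occ [A, C] w' + occ [C, A] w' = occ [A] w * occ [C] w"
    using occ_swap2[of A C] counts by simp_all
  show ?thesis
  proof (cases "occ [C, A] w = 0 \<or> occ [A, C] w = 0 \<or> occ [C, A] w' = 0 \<or> occ [A, C] w' = 0")
    case True
    have "occ [C, A] w = 0 \<longleftrightarrow> occ [C, A] w' = 0"
      using no_CA_invariant[OF eq cl'] no_CA_invariant[OF equ_sym[OF eq] cl] by blast
    moreover have "occ [A, C] w = 0 \<longleftrightarrow> occ [A, C] w' = 0"
      using no_CA_invariant[OF sw(3,2)] no_CA_invariant[OF sw(4,1)] by (auto simp: occ_map_swap)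
    ultimately show ?thesis using True AC_CA by auto
  next
    case False
    show ?thesis
    proof (cases "occ [A] w = 1 \<or> occ [C] w = 1")
      case True
      then show ?thesis using one_A_invariant[OF cl eq] one_C_invariant[OF cl eq] by blast
    next
      case ne1: False
      have "occ [A] w * occ [C] w \<noteq> 0" using False AC_CA(1) by (metis add_is_0)
      then have "occ [A] w \<noteq> 0" "occ [C] w \<noteq> 0" by simp_all
      then have two: "2 \<le> occ [A] w" "2 \<le> occ [C] w" using ne1 by auto
      then have two': "2 \<le> occ [A] w'" "2 \<le> occ [C] w'" using counts by auto
      have shapes: "pattern_acac w \<or> pattern_acaca w \<or> pattern_acacac w \<or>
          pattern_acac (map swap w) \<or> pattern_acaca (map swap w) \<or> pattern_acacac (map swap w)"
        "pattern_acac w' \<or> pattern_acaca w' \<or> pattern_acacac w' \<or>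
          pattern_acac (map swap w') \<or> pattern_acaca (map swap w') \<or> pattern_acacac (map swap w')"
        using False pattern_cases[OF cl _ _ two] pattern_cases[OF cl' _ _ two'] by blast+
      \<comment> \<open>The numbers of letters exclude most pairs of patterns.\<close>
      have nums: "pattern_acaca v \<Longrightarrow> occ [C] v = 2 \<and> occ [A] v \<noteq> 2"
        "pattern_acacac v \<Longrightarrow> occ [C] v \<noteq> 2 \<and> occ [A] v \<noteq> 2" for v
        using pattern_letters[of v] by auto
      have "pattern_acaca w \<or> pattern_acaca w' \<Longrightarrow> occ [C] w = 2 \<and> occ [A] w \<noteq> 2"
        "pattern_acacac w \<or> pattern_acacac w' \<Longrightarrow> occ [C] w \<noteq> 2 \<and> occ [A] w \<noteq> 2"
        using nums[of w] nums[of w'] unfolding counts(1,3) by blast+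
      moreover have "pattern_acaca (map swap w) \<or> pattern_acaca (map swap w') \<Longrightarrow>
          occ [C] w \<noteq> 2 \<and> occ [A] w = 2"
        "pattern_acacac (map swap w) \<or> pattern_acacac (map swap w') \<Longrightarrow>
          occ [C] w \<noteq> 2 \<and> occ [A] w \<noteq> 2"
        using nums[of "map swap w"] nums[of "map swap w'"] unfolding counts(1,3)
        by (simp_all add: occ_map_swap counts(1,3)) blast+
      ultimately consider "pattern_acac w \<or> pattern_acac w'"
        | "pattern_acac (map swap w) \<or> pattern_acac (map swap w')"
        | "pattern_acaca w" "pattern_acaca w'"
        | "pattern_acaca (map swap w)" "pattern_acaca (map swap w')"
        | "pattern_acacac w" "pattern_acacac w'"
        | "pattern_acacac (map swap w)" "pattern_acacac (map swap w')"
        | "pattern_acacac w" "pattern_acacac (map swap w')"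
        | "pattern_acacac (map swap w)" "pattern_acacac w'"
        using shapes by blast
      then show ?thesis
      proof cases
        case 1
        then have "occ [C, A] w = occ [C, A] w'"
          using pattern_acac_CA[OF cl] pattern_acac_CA[OF cl'] eq equ_sym[OF eq] equ_refl by metis
        then show ?thesis using AC_CA by simp
      next
        case 2
        then have "occ [C, A] (map swap w) = occ [C, A] (map swap w')"
          using pattern_acac_CA[OF sw(1)] pattern_acac_CA[OF sw(2)] sw(3,4) equ_refl by metis
        then show ?thesis by (simp add: occ_map_swap)
      next
        case 3
        then show ?thesis using pattern_acaca_AC cl eq by blast
      next
        case 4
        then have "occ [A, C] (map swap w) = occ [A, C] (map swap w')"
          using pattern_acaca_AC sw by blast
        then show ?thesis using AC_CA by (simp add: occ_map_swap)
      next
        case 5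
        then show ?thesis using AC_CA pattern_acacac_counts(1) cl cl' by force
      next
        case 6
        then have "occ [C, A] (map swap w) = occ [C, A] (map swap w')"
          using pattern_acacac_counts(1) sw by simp
        then show ?thesis by (simp add: occ_map_swap)
      next
        case 7
        then show ?thesis
          using pattern_acacac_counts(2)[OF cl] pattern_acacac_swap_counts[of w'] counts by simp
      next
        case 8
        then show ?thesis
          using pattern_acacac_counts(2)[OF cl'] pattern_acacac_swap_counts[of w] counts by simp
      qed
    qed
  qed
qed


section \<open>Parikh matrices count contiguous patterns\<close>

lemma parikh_matrix_entry:
  assumes "finite S" "i \<le> card S" "j \<le> card S"
  shows "parikh_matrix S w $$ (i, j) =
    (if i \<le> j then occ (take (j - i) (drop i (sorted_list_of_set S))) w else 0)"
  using assms(2,3)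
proof (induction w arbitrary: i j)
  case Nil
  define v where "v = take (j - i) (drop i (sorted_list_of_set S))"
  have "length v = j - i" using Nil unfolding v_def by simp
  then have "i \<le> j \<Longrightarrow> occ v [] = (if i = j then 1 else 0)" by (cases v) auto
  then show ?case using Nil unfolding v_def by auto
next
  case (Cons x w)
  let ?L = "sorted_list_of_set S" and ?n = "Suc (card S)"
  have "parikh_matrix S (x # w) $$ (i, j) =
      (\<Sum>k = 0..<?n. letter_matrix S x $$ (i, k) * parikh_matrix S w $$ (k, j))"
    using Cons.prems carrier_matD[OF letter_matrix_carrier[of S x]]
      carrier_matD[OF parikh_matrix_carrier[of S w]]
    by (simp add: scalar_prod_def)
  also have "\<dots> = (\<Sum>k = 0..<?n. (if k = i then parikh_matrix S w $$ (i, j) else 0) +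
      (if k = Suc i then if ?L ! i = x then parikh_matrix S w $$ (Suc i, j) else 0 else 0))"
    using Cons.prems by (intro sum.cong) (auto simp: letter_matrix_def)
  also have "\<dots> = parikh_matrix S w $$ (i, j) +
      (if i < card S \<and> ?L ! i = x then parikh_matrix S w $$ (Suc i, j) else 0)"
    using Cons.prems by (simp add: sum.distrib)
  also have "\<dots> = (if i \<le> j then occ (take (j - i) (drop i ?L)) (x # w) else 0)"
  proof (cases "i < j")
    case True
    then have "drop i ?L = ?L ! i # drop (Suc i) ?L"
      using Cons.prems assms(1) by (simp add: Cons_nth_drop_Suc)
    moreover have "j - i = Suc (j - Suc i)" using True by simp
    ultimately have "take (j - i) (drop i ?L) = ?L ! i # take (j - Suc i) (drop (Suc i) ?L)"
      by simp
    then show ?thesis using True Cons.prems Cons.IH[of i j] Cons.IH[of "Suc i" j] by simp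
  next
    case False
    then show ?thesis using Cons.prems Cons.IH[of i j] Cons.IH[of "Suc i" j] by auto
  qed
  finally show ?case .
qed

lemma parikh_matrix_eqI:
  assumes "finite S" "\<And>v. sorted_wrt (<) v \<Longrightarrow> set v \<subseteq> S \<Longrightarrow> occ v w = occ v w'"
  shows "parikh_matrix S w = parikh_matrix S w'"
proof (rule eq_matI)
  note dims = carrier_matD[OF parikh_matrix_carrier]
  fix i j assume "i < dim_row (parikh_matrix S w')" "j < dim_col (parikh_matrix S w')"
  then have ij: "i \<le> card S" "j \<le> card S" by (simp_all add: dims)
  let ?v = "take (j - i) (drop i (sorted_list_of_set S))"
  have "sorted_wrt (<) ?v" by (intro sorted_wrt_take sorted_wrt_drop) simp
  moreover have "set ?v \<subseteq> S" using assms(1) by (metis in_set_dropD in_set_takeD set_sorted_list_of_set subsetI)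
  ultimately show "parikh_matrix S w $$ (i, j) = parikh_matrix S w' $$ (i, j)"
    using assms ij by (simp add: parikh_matrix_entry)
qed (simp_all add: carrier_matD[OF parikh_matrix_carrier])

context
  fixes a b c :: "'a::linorder"
  assumes less: "a < b" "b < c"
begin

lemma neq: "a \<noteq> b" "b \<noteq> c" "a \<noteq> c" "b \<noteq> a" "c \<noteq> b" "c \<noteq> a"
  and le: "a \<le> b" "b \<le> c" "a \<le> c"
  using less by auto

text \<open>The embedding of the abstract letters into the given ordered alphabet.\<close>

primrec emb :: "letter \<Rightarrow> 'a" where
  "emb A = a" | "emb B = b" | "emb C = c"

lemma inj_emb: "inj emb"
proof (rule injI)
  fix x y assume "emb x = emb y"
  then show "x = y" using less by (cases x; cases y) auto
qed

lemma lists_emb: "w \<in> lists {a, b, c} \<longleftrightarrow> (\<exists>u. w = map emb u)"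
proof
  show "\<exists>u. w = map emb u" if "w \<in> lists {a, b, c}"
    using that
  proof (induction w)
    case (Cons x w)
    then obtain u where "w = map emb u" by auto
    moreover obtain y where "x = emb y" using Cons.hyps(1) emb.simps by (metis empty_iff insert_iff)
    ultimately show ?case by (intro exI[of _ "y # u"]) simp
  qed simp
  have "emb x \<in> {a, b, c}" for x by (cases x) auto
  then have "set (map emb u) \<subseteq> {a, b, c}" for u by (metis image_subsetI list.set_map)
  then show "w \<in> lists {a, b, c}" if "\<exists>u. w = map emb u"
    using that by (metis in_lists_conv_set subsetD)
qed

lemma sorted_abc: "sorted_list_of_set {a, b, c} = [a, b, c]"
  and sorted_ac: "sorted_list_of_set {a, c} = [a, c]"
  and card_abc: "card {a, b, c} = 3" and card_ac: "card {a, c} = 2"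
  by (simp_all add: neq le insert_Diff_if)

text \<open>The patterns counted by the Parikh matrices of all projections: besides those counted by the
  full Parikh matrix, this is only \<open>ac\<close>.\<close>

lemma sorted_words:
  assumes "sorted_wrt (<) v" "set v \<subseteq> {a, b, c}"
  shows "v \<in> map emb ` {[], [A], [B], [C], [A, B], [B, C], [A, B, C], [A, C]}"
proof -
  have "set v \<in> Pow {a, b, c}" using assms by auto
  moreover have "v = sorted_list_of_set (set v)"
    using assms(1) by (simp add: sorted_list_of_set.idem_if_sorted_distinct strict_sorted_iff)
  ultimately show ?thesis by (auto simp: Pow_insert insert_Diff_if neq le)
qed

lemma M_equiv_emb: "M_equiv {a, b, c} (map emb u) (map emb u') \<longleftrightarrow> equ u u'"
proof
  assume "M_equiv {a, b, c} (map emb u) (map emb u')"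
  then have "parikh_matrix {a, b, c} (map emb u) = parikh_matrix {a, b, c} (map emb u')"
    by (simp add: M_equiv_def)
  then have *: "occ (take (j - i) (drop i [a, b, c])) (map emb u) =
      occ (take (j - i) (drop i [a, b, c])) (map emb u')" if "i \<le> j" "j \<le> 3" for i j
    using parikh_matrix_entry[of "{a, b, c}" i j "map emb u"]
      parikh_matrix_entry[of "{a, b, c}" i j "map emb u'"] that
    by (simp add: sorted_abc card_abc)
  have "occ (map emb v) (map emb u) = occ (map emb v) (map emb u')"
    if "v \<in> {[A], [B], [C], [A, B], [B, C], [A, B, C]}" for v
    using that *[of 0 1] *[of 1 2] *[of 2 3] *[of 0 2] *[of 1 3] *[of 0 3]
    by (auto simp: numeral_3_eq_3 numeral_2_eq_2)
  then show "equ u u'" unfolding equ_def by (simp add: occ_map[OF inj_emb])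
next
  assume eq: "equ u u'"
  have "parikh_matrix {a, b, c} (map emb u) = parikh_matrix {a, b, c} (map emb u')"
  proof (rule eq_matI)
    note dims = carrier_matD[OF parikh_matrix_carrier]
    fix i j assume "i < dim_row (parikh_matrix {a, b, c} (map emb u'))"
      "j < dim_col (parikh_matrix {a, b, c} (map emb u'))"
    then have ij: "i \<le> 3" "j \<le> 3" by (simp_all add: dims card_abc)
    let ?v = "take (j - i) (drop i [A, B, C])"
    have "?v \<in> {[], [A], [B], [C], [A, B], [B, C], [A, B, C]}"
      using ij by (auto simp: le_Suc_eq numeral_3_eq_3)
    then have "occ ?v u = occ ?v u'" using eq by (auto simp: equ_def)
    then have "occ (map emb ?v) (map emb u) = occ (map emb ?v) (map emb u')"
      by (simp only: occ_map[OF inj_emb])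
    moreover have "map emb ?v = take (j - i) (drop i [a, b, c])" by (simp flip: take_map drop_map)
    ultimately show "parikh_matrix {a, b, c} (map emb u) $$ (i, j) =
        parikh_matrix {a, b, c} (map emb u') $$ (i, j)"
      using ij parikh_matrix_entry[of "{a, b, c}" i j]
      by (simp add: sorted_abc card_abc)
  qed (simp_all add: carrier_matD[OF parikh_matrix_carrier])
  moreover have "map emb u \<in> lists {a, b, c}" "map emb u' \<in> lists {a, b, c}"
    using lists_emb by blast+
  ultimately show "M_equiv {a, b, c} (map emb u) (map emb u')" by (simp add: M_equiv_def)
qed

lemma P_distinct_emb:
  assumes "equ u u'"
  shows "P_distinct {a, b, c} (map emb u) (map emb u') \<longleftrightarrow> occ [A, C] u \<noteq> occ [A, C] u'"
proof
  assume "P_distinct {a, b, c} (map emb u) (map emb u')"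
  then obtain S where S: "S \<subseteq> {a, b, c}"
    "parikh_matrix S (projection S (map emb u)) \<noteq> parikh_matrix S (projection S (map emb u'))"
    unfolding P_distinct_def by blast
  show "occ [A, C] u \<noteq> occ [A, C] u'"
  proof
    assume ac: "occ [A, C] u = occ [A, C] u'"
    have "parikh_matrix S (projection S (map emb u)) = parikh_matrix S (projection S (map emb u'))"
    proof (rule parikh_matrix_eqI)
      show "finite S" using S finite_subset by blast
      fix v assume v: "sorted_wrt (<) v" "set v \<subseteq> S"
      then obtain p where p: "p \<in> {[], [A], [B], [C], [A, B], [B, C], [A, B, C], [A, C]}"
        "v = map emb p" using sorted_words[of v] S by blast
      have "occ p u = occ p u'" using p(1) ac assms by (auto simp: equ_def)
      then show "occ v (projection S (map emb u)) = occ v (projection S (map emb u'))"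
        unfolding projection_def using v p(2) by (simp only: occ_filter occ_map[OF inj_emb])
    qed
    then show False using S by blast
  qed
next
  assume ac: "occ [A, C] u \<noteq> occ [A, C] u'"
  have "parikh_matrix {a, c} (projection {a, c} (map emb w)) $$ (0, 2) = occ [A, C] w" for w
    using parikh_matrix_entry[of "{a, c}" 0 2 "projection {a, c} (map emb w)"]
      occ_filter[of "[a, c]" "{a, c}" "map emb w"] occ_map[OF inj_emb, of "[A, C]" w]
    by (simp add: sorted_ac card_ac projection_def)
  then have "parikh_matrix {a, c} (projection {a, c} (map emb u)) \<noteq>
      parikh_matrix {a, c} (projection {a, c} (map emb u'))" using ac by metis
  then show "P_distinct {a, b, c} (map emb u) (map emb u')"
    unfolding P_distinct_def by (intro exI[of _ "{a, c}"]) auto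
qed

lemma sublist_map_emb: "sublist (map emb s) (map emb w) \<longleftrightarrow> sublist s w"
proof
  assume "sublist (map emb s) (map emb w)"
  then obtain p q where "map emb w = p @ map emb s @ q" by (auto simp: sublist_def)
  then obtain p' s' q' where "w = p' @ s' @ q'" "map emb s' = map emb s"
    by (auto simp: map_eq_append_conv append_eq_map_conv)
  then show "sublist s w" using inj_emb by (metis inj_map_eq_map sublist_appendI)
qed (rule map_mono_sublist)

lemma M_class_emb: "M_class {a, b, c} (map emb u) = map emb ` {u'. equ u u'}"
proof
  show "M_class {a, b, c} (map emb u) \<subseteq> map emb ` {u'. equ u u'}"
  proof
    fix w assume w: "w \<in> M_class {a, b, c} (map emb u)"
    then have "w \<in> lists {a, b, c}" by (simp add: M_class_def M_equiv_def)
    then obtain u' where "w = map emb u'" using lists_emb by blast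
    then show "w \<in> map emb ` {u'. equ u u'}" using w by (simp add: M_class_def M_equiv_emb)
  qed
qed (auto simp: M_class_def M_equiv_emb)

lemma trivially_P_distinguishable_emb:
  "trivially_P_distinguishable {a, b, c} (map emb u) \<longleftrightarrow> \<not> clean u"
proof -
  have idx: "(\<exists>i<card {a, b, c}. \<exists>j<card {a, b, c}. \<bar>int i - int j\<bar> \<ge> 2 \<and>
      sublist [sorted_list_of_set {a, b, c} ! i, sorted_list_of_set {a, b, c} ! j] w) \<longleftrightarrow>
      sublist [a, c] w \<or> sublist [c, a] w" for w
    unfolding sorted_abc card_abc numeral_3_eq_3 by (simp add: Ex_less_Suc2)
  have emb: "sublist [a, c] (map emb w) \<longleftrightarrow> sublist [A, C] w"
    "sublist [c, a] (map emb w) \<longleftrightarrow> sublist [C, A] w" for w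
    using sublist_map_emb[of "[A, C]" w] sublist_map_emb[of "[C, A]" w] by simp_all
  show ?thesis
    unfolding trivially_P_distinguishable_def idx clean_def M_class_emb by (auto simp: emb)
qed

lemma P_distinguishable_emb:
  "P_distinguishable {a, b, c} (map emb u) \<longleftrightarrow> (\<exists>u'. equ u u' \<and> occ [A, C] u \<noteq> occ [A, C] u')"
  unfolding P_distinguishable_def M_class_emb by (auto simp: P_distinct_emb)

end

section \<open>The characterization of distinguishable classes\<close>

lemma clean_iff_AC_constant: "clean u \<longleftrightarrow> \<not> (\<exists>u'. equ u u' \<and> occ [A, C] u \<noteq> occ [A, C] u')"
proof
  show "\<not> (\<exists>u'. equ u u' \<and> occ [A, C] u \<noteq> occ [A, C] u')" if "clean u"
    using clean_AC_invariant[OF that] by blast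
  show "clean u" if const: "\<not> (\<exists>u'. equ u u' \<and> occ [A, C] u \<noteq> occ [A, C] u')"
  proof (rule ccontr)
    assume "\<not> clean u"
    then obtain p q where "equ u (p @ [A, C] @ q) \<or> equ u (p @ [C, A] @ q)"
      unfolding clean_def sublist_def by blast
    moreover have "equ (p @ [A, C] @ q) (p @ [C, A] @ q)" "equ (p @ [C, A] @ q) (p @ [A, C] @ q)"
      by (auto simp: equ_def occ_append)
    ultimately have "equ u (p @ [A, C] @ q)" "equ u (p @ [C, A] @ q)"
      using equ_trans by blast+
    then have "occ [A, C] (p @ [A, C] @ q) = occ [A, C] (p @ [C, A] @ q)"
      using const by metis
    then show False by (simp add: occ_append)
  qed
qed

theorem theorem5p1:
  fixes a b c :: "'a::linorder" and w :: "'a list"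
  assumes "a < b" and "b < c"
    and "w \<in> lists {a, b, c}"
    and "M_ambiguous {a, b, c} w"
  shows "P_distinguishable {a, b, c} w \<longleftrightarrow> trivially_P_distinguishable {a, b, c} w"
proof -
  obtain u where "w = map (emb a b c) u"
    using assms(3) lists_emb[OF assms(1,2)] by blast
  then show ?thesis
    using P_distinguishable_emb[OF assms(1,2)] trivially_P_distinguishable_emb[OF assms(1,2)]
      clean_iff_AC_constant by simp
qed

end
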